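(* Let $m,n$ be coprime positive integers and $G=\langle x,y\mid x^m=y^n\rangle$. Let $Y_{red}$ be the set of characters of reducible $SU(2)$-representations of $G$, regarded inside the $SL(2,\mathbb{C})$-character variety of $G$. Then there is an isomorphism (of topological spaces) $Y_{red}\cong[-2,2]\subset\mathbb{R}$.
   Context: An $SU(2)$-representation of $G$ is a homomorphism $\rho:G\to SU(2)$; equivalently a pair $(A,B)=(\rho(x),\rho(y))$ of matrices in $SU(2)$ with $A^m=B^n$. It is regarded as an $SL(2,\mathbb{C})$-representation via $SU(2)\subset SL(2,\mathbb{C})$. It is reducible if the matrices $\rho(g)$, $g\in G$, have a common eigenvector in $\mathbb{C}^2$. The character of $\rho$ is $\chi_\rho:G\to\mathbb{C}$, $\chi_\rho(g)=\operatorname{tr}\rho(g)$. The character variety $X_{SL(2,\mathbb{C})}(G)\subset\mathbb{C}^G$ is the set of characters of all homomorphisms $G\to SL(2,\mathbb{C})$; its (classical) topology is that of pointwise convergence of characters, and $Y_{red}$ carries the subspace topology. *)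

theory Defs
  imports "HOL-Analysis.Analysis" "HOL-Algebra.Group"
begin

(* A letter (s, True) stands for the generator s, and (s, False) for its formal inverse. *)
type_synonym 's word = "('s \<times> bool) list"

(* The least congruence on the monoid of words that makes (s, e) and (s, \<not> e) cancel and
   identifies the two sides of every relation in R. *)
inductive pres_eq :: "('s word \<times> 's word) set \<Rightarrow> 's word \<Rightarrow> 's word \<Rightarrow> bool"
  for R :: "('s word \<times> 's word) set" where
  refl: "pres_eq R u u"
| sym: "pres_eq R u v \<Longrightarrow> pres_eq R v u"
| trans: "pres_eq R u v \<Longrightarrow> pres_eq R v w \<Longrightarrow> pres_eq R u w"
| append: "pres_eq R u v \<Longrightarrow> pres_eq R u' v' \<Longrightarrow> pres_eq R (u @ u') (v @ v')"
| cancel: "pres_eq R [(s, e), (s, \<not> e)] []"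
| relation: "(u, v) \<in> R \<Longrightarrow> pres_eq R u v"

definition word_class :: "('s word \<times> 's word) set \<Rightarrow> 's word \<Rightarrow> 's word set" where
  "word_class R u = {v. pres_eq R u v}"

(* The group presented by all elements of the type 's as generators and the relations
   u = v for (u, v) in R. *)
definition presented_group :: "('s word \<times> 's word) set \<Rightarrow> 's word set monoid" where
  "presented_group R =
     \<lparr>carrier = range (word_class R),
      mult = (\<lambda>P Q. {w. \<exists>u\<in>P. \<exists>v\<in>Q. pres_eq R (u @ v) w}),
      one = word_class R []\<rparr>"

lemma word_class_eq_iff: "word_class R u = word_class R v \<longleftrightarrow> pres_eq R u v"
  unfolding word_class_def by (auto intro: pres_eq.refl pres_eq.sym pres_eq.trans)

lemma word_class_mult:
  "word_class R u \<otimes>\<^bsub>presented_group R\<^esub> word_class R v = word_class R (u @ v)"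
  unfolding word_class_def presented_group_def
  by (auto intro: pres_eq.refl pres_eq.sym pres_eq.trans pres_eq.append)

lemma pres_eq_inverse: "\<exists>v. pres_eq R (v @ u) []"
proof (induction u)
  case Nil
  show ?case by (auto intro: pres_eq.refl)
next
  case (Cons a u)
  then obtain v where v: "pres_eq R (v @ u) []" by blast
  obtain s e where a: "a = (s, e)" by (cases a)
  have "pres_eq R [(s, \<not> e), (s, e)] []" using pres_eq.cancel[of R s "\<not> e"] by simp
  then have "pres_eq R (v @ [(s, \<not> e), (s, e)] @ u) (v @ [] @ u)"
    by (intro pres_eq.append pres_eq.refl)
  then have "pres_eq R ((v @ [(s, \<not> e)]) @ a # u) []"
    using v a by (auto intro: pres_eq.trans)
  then show ?case by blast
qed

lemma group_presented_group: "group (presented_group R)"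
proof (rule groupI)
  let ?G = "presented_group R"
  have carr: "carrier ?G = range (word_class R)" and one: "\<one>\<^bsub>?G\<^esub> = word_class R []"
    by (simp_all add: presented_group_def)
  show "\<one>\<^bsub>?G\<^esub> \<in> carrier ?G" by (simp add: carr one)
  show "x \<otimes>\<^bsub>?G\<^esub> y \<in> carrier ?G" if "x \<in> carrier ?G" "y \<in> carrier ?G" for x y
    using that by (auto simp: carr word_class_mult)
  show "x \<otimes>\<^bsub>?G\<^esub> y \<otimes>\<^bsub>?G\<^esub> z = x \<otimes>\<^bsub>?G\<^esub> (y \<otimes>\<^bsub>?G\<^esub> z)"
    if "x \<in> carrier ?G" "y \<in> carrier ?G" "z \<in> carrier ?G" for x y z
    using that by (auto simp: carr word_class_mult)
  show "\<one>\<^bsub>?G\<^esub> \<otimes>\<^bsub>?G\<^esub> x = x" if "x \<in> carrier ?G" for x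
    using that by (auto simp: carr one word_class_mult)
  show "\<exists>y\<in>carrier ?G. y \<otimes>\<^bsub>?G\<^esub> x = \<one>\<^bsub>?G\<^esub>" if x: "x \<in> carrier ?G" for x
  proof -
    obtain u where u: "x = word_class R u" using x by (auto simp: carr)
    obtain v where "pres_eq R (v @ u) []" using pres_eq_inverse by blast
    then have "word_class R v \<otimes>\<^bsub>?G\<^esub> x = \<one>\<^bsub>?G\<^esub>"
      by (simp add: u one word_class_mult word_class_eq_iff)
    then show ?thesis by (auto simp: carr)
  qed
qed

datatype gen = X | Y

definition torus_group :: "nat \<Rightarrow> nat \<Rightarrow> gen word set monoid" where
  "torus_group m n = presented_group {(replicate m (X, True), replicate n (Y, True))}"

definition SL2C :: "(complex^2^2) monoid" where
  "SL2C = \<lparr>carrier = {A. det A = 1}, mult = (**), one = mat 1\<rparr>"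

definition conj_transpose :: "complex^'n^'m \<Rightarrow> complex^'m^'n" where
  "conj_transpose A = (\<chi> i j. cnj (A $ j $ i))"

definition SU2 :: "(complex^2^2) monoid" where
  "SU2 = \<lparr>carrier = {A. A ** conj_transpose A = mat 1 \<and> conj_transpose A ** A = mat 1 \<and> det A = 1},
          mult = (**), one = mat 1\<rparr>"

lemma group_SL2C: "group SL2C"
proof (rule groupI)
  show "\<exists>B\<in>carrier SL2C. B \<otimes>\<^bsub>SL2C\<^esub> A = \<one>\<^bsub>SL2C\<^esub>" if A: "A \<in> carrier SL2C" for A
  proof -
    have "det A = 1" using A by (simp add: SL2C_def)
    then have "invertible A" by (simp add: invertible_det_nz)
    then obtain B where B: "B ** A = mat 1" unfolding invertible_def by blast
    then have "det B * det A = 1" by (metis det_mul det_I)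
    then show ?thesis using B \<open>det A = 1\<close> by (auto simp: SL2C_def)
  qed
qed (auto simp: SL2C_def det_mul det_I matrix_mul_assoc)

lemma subgroup_SU2: "subgroup (carrier SU2) SL2C"
proof (rule group.subgroupI[OF group_SL2C])
  have ct_mult: "conj_transpose (A ** B) = conj_transpose B ** conj_transpose A"
    for A B :: "complex^2^2"
    by (simp add: conj_transpose_def matrix_matrix_mult_def vec_eq_iff mult.commute)
  have ct_one: "conj_transpose (mat 1 :: complex^2^2) = mat 1"
    by (simp add: conj_transpose_def mat_def vec_eq_iff)
  have ct_ct: "conj_transpose (conj_transpose A) = A" for A :: "complex^2^2"
    by (simp add: conj_transpose_def vec_eq_iff)
  show "carrier SU2 \<subseteq> carrier SL2C" by (auto simp: SU2_def SL2C_def)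
  show "carrier SU2 \<noteq> {}"
    using ct_one by (auto simp: SU2_def intro!: exI[of _ "mat 1"])
  show "A \<otimes>\<^bsub>SL2C\<^esub> B \<in> carrier SU2" if "A \<in> carrier SU2" "B \<in> carrier SU2" for A B
  proof -
    have "(A ** B) ** conj_transpose (A ** B) = A ** (B ** conj_transpose B) ** conj_transpose A"
      and "conj_transpose (A ** B) ** (A ** B) = conj_transpose B ** (conj_transpose A ** A) ** B"
      by (simp_all add: ct_mult matrix_mul_assoc)
    then show ?thesis using that by (simp add: SU2_def SL2C_def det_mul)
  qed
  show "inv\<^bsub>SL2C\<^esub> A \<in> carrier SU2" if A: "A \<in> carrier SU2" for A
  proof -
    have *: "A ** conj_transpose A = mat 1" "conj_transpose A ** A = mat 1" "det A = 1"
      using A by (auto simp: SU2_def)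
    then have "det (conj_transpose A) = 1" by (metis det_mul det_I mult_1)
    then have "inv\<^bsub>SL2C\<^esub> A = conj_transpose A"
      using * by (intro group.inv_equality[OF group_SL2C]) (auto simp: SL2C_def)
    then show ?thesis using * \<open>det (conj_transpose A) = 1\<close> by (simp add: SU2_def ct_ct)
  qed
qed

definition reducible_rep :: "('a, 'b) monoid_scheme \<Rightarrow> ('a \<Rightarrow> complex^2^2) \<Rightarrow> bool" where
  "reducible_rep G \<rho> \<longleftrightarrow> (\<exists>v. v \<noteq> 0 \<and> (\<forall>g\<in>carrier G. \<exists>c. \<rho> g *v v = c *s v))"

definition rep_character ::
    "('a, 'b) monoid_scheme \<Rightarrow> ('a \<Rightarrow> complex^2^2) \<Rightarrow> 'a \<Rightarrow> complex" where
  "rep_character G \<rho> = (\<lambda>g\<in>carrier G. trace (\<rho> g))"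

definition character_set :: "('a, 'b) monoid_scheme \<Rightarrow> ('a \<Rightarrow> complex) set" where
  "character_set G = rep_character G ` hom G SL2C"

(* The product topology is that of pointwise convergence; its points are the functions on
   carrier G, extended by undefined, as produced by rep_character. *)
definition character_variety :: "('a, 'b) monoid_scheme \<Rightarrow> ('a \<Rightarrow> complex) topology" where
  "character_variety G =
     subtopology (product_topology (\<lambda>_. euclidean) (carrier G)) (character_set G)"

definition Y_red :: "('a, 'b) monoid_scheme \<Rightarrow> ('a \<Rightarrow> complex) set" where
  "Y_red G = rep_character G ` {\<rho> \<in> hom G SU2. reducible_rep G \<rho>}"

lemma topspace_character_variety: "topspace (character_variety G) = character_set G"
  by (auto simp: character_variety_def character_set_def rep_character_def)

lemma Y_red_subset: "Y_red G \<subseteq> topspace (character_variety G)"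
proof -
  have "hom G SU2 \<subseteq> hom G SL2C" by (auto simp: hom_def SU2_def SL2C_def Pi_iff)
  then show ?thesis
    unfolding topspace_character_variety by (auto simp: Y_red_def character_set_def)
qed

end

theory Submission
  imports Defs
begin

text \<open>The abelianization of \<open>G\<close> is infinite cyclic: \<open>x \<mapsto> n\<close>, \<open>y \<mapsto> m\<close> defines a homomorphism
  \<open>w : G \<rightarrow> \<int>\<close>, onto because \<open>m\<close> and \<open>n\<close> are coprime. On a common eigenvector a reducible
  \<open>SU(2)\<close>-representation acts by a unitary character of \<open>G\<close>, that is by \<open>g \<mapsto> cis (w g * \<theta>)\<close>, and its
  trace is \<open>2 cos (w g * \<theta>)\<close>. All these traces are determined by the value \<open>s = 2 cos \<theta>\<close> at an
  element of weight one, and they depend continuously on \<open>s \<in> [-2,2]\<close>.\<close>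

section \<open>Weights of words and of group elements\<close>

definition letter_weight :: "nat \<Rightarrow> nat \<Rightarrow> gen \<times> bool \<Rightarrow> int" where
  "letter_weight m n a =
     (case fst a of X \<Rightarrow> int n | Y \<Rightarrow> int m) * (if snd a then 1 else -1)"

definition weight :: "nat \<Rightarrow> nat \<Rightarrow> gen word \<Rightarrow> int" where
  "weight m n u = sum_list (map (letter_weight m n) u)"

abbreviation torus_class :: "nat \<Rightarrow> nat \<Rightarrow> gen word \<Rightarrow> gen word set" where
  "torus_class m n \<equiv> word_class {(replicate m (X, True), replicate n (Y, True))}"

text \<open>Any representative may be chosen: by \<open>weight_pres_eq\<close> the weight is
  constant on each class.\<close>

definition class_weight :: "nat \<Rightarrow> nat \<Rightarrow> gen word set \<Rightarrow> int" where
  "class_weight m n P = weight m n (SOME u. u \<in> P)"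

lemma weight_Nil [simp]: "weight m n [] = 0"
  and weight_Cons [simp]: "weight m n (a # u) = letter_weight m n a + weight m n u"
  and weight_append [simp]: "weight m n (u @ v) = weight m n u + weight m n v"
  and weight_replicate [simp]: "weight m n (replicate k a) = int k * letter_weight m n a"
  by (simp_all add: weight_def sum_list_replicate)

text \<open>Cancelling letters have opposite weights, and both sides of the relation
  \<open>x^m = y^n\<close> weigh \<open>m * n\<close>.\<close>

lemma weight_pres_eq:
  assumes "pres_eq {(replicate m (X, True), replicate n (Y, True))} u v"
  shows "weight m n u = weight m n v"
  using assms by induction (auto simp: letter_weight_def)

lemma class_weight_word_class [simp]: "class_weight m n (torus_class m n u) = weight m n u"
proof -
  have "u \<in> torus_class m n u" by (simp add: word_class_def pres_eq.refl)
  then have "(SOME v. v \<in> torus_class m n u) \<in> torus_class m n u" by (rule someI)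
  then show ?thesis
    unfolding class_weight_def by (simp add: word_class_def weight_pres_eq)
qed

lemma carrier_torus_group: "carrier (torus_group m n) = range (torus_class m n)"
  by (simp add: torus_group_def presented_group_def)

lemma torus_class_mult:
  "torus_class m n u \<otimes>\<^bsub>torus_group m n\<^esub> torus_class m n v = torus_class m n (u @ v)"
  by (simp add: torus_group_def word_class_mult)

lemma exists_weight_one:
  assumes "coprime m n"
  shows "\<exists>u. weight m n u = 1"
proof -
  obtain p q where pq: "p * int m + q * int n = 1"
    using bezout_int[of "int m" "int n"] assms by auto
  \<comment> \<open>The sign of each Bezout coefficient selects the generator or its inverse; for a
    zero coefficient the block is empty, so its flag does not matter.\<close>
  have *: "weight m n (replicate (nat \<bar>q\<bar>) (X, q > 0) @ replicate (nat \<bar>p\<bar>) (Y, p > 0)) = 1"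
    using pq by (auto simp: letter_weight_def abs_if not_less)
  then show ?thesis by blast
qed

section \<open>Diagonal matrices and eigenvalues in SU(2)\<close>

definition torus_diag :: "complex \<Rightarrow> complex^2^2" where
  "torus_diag z = (\<chi> i j. if i = j then (if i = 1 then z else cnj z) else 0)"

lemma torus_diag_mult: "torus_diag (z * w) = torus_diag z ** torus_diag w"
  by (simp add: torus_diag_def matrix_matrix_mult_def vec_eq_iff forall_2 sum_2)

lemma torus_diag_SU2: "cmod z = 1 \<Longrightarrow> torus_diag z \<in> carrier SU2"
  by (simp add: SU2_def torus_diag_def conj_transpose_def matrix_matrix_mult_def
      mat_def vec_eq_iff forall_2 sum_2 det_2 complex_norm_square[symmetric] mult.commute)

lemma trace_torus_diag: "trace (torus_diag z) = of_real (2 * Re z)"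
  by (simp add: trace_def torus_diag_def sum_2 complex_add_cnj)

text \<open>A unitary matrix preserves the Hermitian norm, so \<open>v\<close> and
  \<open>c *s v\<close> have the same nonzero norm.\<close>

lemma unitary_eigenvalue_norm:
  fixes A :: "complex^2^2"
  assumes A: "conj_transpose A ** A = mat 1" and v: "v \<noteq> 0" and ev: "A *v v = c *s v"
  shows "cmod c = 1"
proof -
  have e: "cnj (A$1$1) * A$1$1 + cnj (A$2$1) * A$2$1 = 1"
    "cnj (A$1$1) * A$1$2 + cnj (A$2$1) * A$2$2 = 0"
    "cnj (A$1$2) * A$1$1 + cnj (A$2$2) * A$2$1 = 0"
    "cnj (A$1$2) * A$1$2 + cnj (A$2$2) * A$2$2 = 1"
    using A by (simp_all add: vec_eq_iff forall_2 conj_transpose_def matrix_matrix_mult_def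
        mat_def sum_2)
  have f: "c * v$1 = A$1$1 * v$1 + A$1$2 * v$2" "c * v$2 = A$2$1 * v$1 + A$2$2 * v$2"
    using ev by (simp_all add: vec_eq_iff forall_2 matrix_vector_mult_def sum_2)
  let ?N = "cnj (v$1) * v$1 + cnj (v$2) * v$2"
  have N: "?N = of_real ((cmod (v$1))\<^sup>2 + (cmod (v$2))\<^sup>2)"
    by (simp only: of_real_add complex_norm_square mult.commute)
  have "(cmod (v$1))\<^sup>2 + (cmod (v$2))\<^sup>2 \<noteq> 0"
    using v by (simp add: vec_eq_iff forall_2 sum_power2_eq_zero_iff)
  then have N0: "?N \<noteq> 0" unfolding N by (simp only: of_real_eq_0_iff not_False_eq_True)
  have "cnj c * c * ?N = cnj (c * v$1) * (c * v$1) + cnj (c * v$2) * (c * v$2)"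
    by (simp add: algebra_simps)
  \<comment> \<open>The Hermitian form is grouped by the entries of
    \<open>conj_transpose A ** A\<close>, which the equations \<open>e\<close> evaluate to those of
    the identity.\<close>
  also have "\<dots> = (cnj (A$1$1) * A$1$1 + cnj (A$2$1) * A$2$1) * (cnj (v$1) * v$1)
     + (cnj (A$1$1) * A$1$2 + cnj (A$2$1) * A$2$2) * (cnj (v$1) * v$2)
     + (cnj (A$1$2) * A$1$1 + cnj (A$2$2) * A$2$1) * (cnj (v$2) * v$1)
     + (cnj (A$1$2) * A$1$2 + cnj (A$2$2) * A$2$2) * (cnj (v$2) * v$2)"
    unfolding f by (simp add: algebra_simps)
  also have "\<dots> = ?N" unfolding e by simp
  finally have "cnj c * c = 1" using N0 by simp
  then have "(cmod c)\<^sup>2 = 1"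
    by (metis complex_norm_square mult.commute of_real_eq_1_iff)
  then show ?thesis using norm_ge_zero[of c] by (simp add: power2_eq_1_iff)
qed

text \<open>The eigenvalue is a root of the characteristic polynomial, whose constant term is 1.
  Since \<open>c * cnj c = 1\<close>, the other root is \<open>cnj c\<close>, and the trace is the
  sum of the two.\<close>

lemma trace_eigenvalue:
  fixes A :: "complex^2^2"
  assumes A: "A \<in> carrier SU2" and v: "v \<noteq> 0" and ev: "A *v v = c *s v"
  shows "trace A = of_real (2 * Re c)"
proof -
  have "cmod c = 1" using A v ev by (auto simp: SU2_def intro: unitary_eigenvalue_norm)
  then have cc: "c * cnj c = 1" by (simp add: complex_norm_square[symmetric])
  have d: "A$1$1 * A$2$2 - A$1$2 * A$2$1 = 1" using A by (simp add: SU2_def det_2)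
  have f: "c * v$1 = A$1$1 * v$1 + A$1$2 * v$2" "c * v$2 = A$2$1 * v$1 + A$2$2 * v$2"
    using ev by (simp_all add: vec_eq_iff forall_2 matrix_vector_mult_def sum_2)
  \<comment> \<open>Eliminating one coordinate from the eigenvector equations leaves the
    characteristic polynomial at \<open>c\<close> times the other.\<close>
  have "(c * c - (A$1$1 + A$2$2) * c + 1) * v$1 = 0" "(c * c - (A$1$1 + A$2$2) * c + 1) * v$2 = 0"
    using f d by algebra+
  moreover have "v$1 \<noteq> 0 \<or> v$2 \<noteq> 0" using v by (simp add: vec_eq_iff forall_2)
  ultimately have q: "c * c - (A$1$1 + A$2$2) * c + 1 = 0" by auto
  have "A$1$1 + A$2$2 = c + cnj c" using q cc by algebra
  then show ?thesis by (simp add: trace_def sum_2 complex_add_cnj)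
qed

text \<open>With \<open>p * m + q * n = 1\<close>, the element \<open>t = a^q * b^p\<close>
  satisfies \<open>t^n = a^(q*n) * (b^n)^p = a^(q*n + m*p) = a\<close>, and symmetrically
  \<open>t^m = b\<close>. Applied to the eigenvalues of the two generators, this makes a scalar
  character factor through the weight.\<close>

lemma coprime_powers_common_base:
  fixes a b :: "'a::field"
  assumes "coprime m n" "a \<noteq> 0" "b \<noteq> 0" "a ^ m = b ^ n"
  shows "\<exists>p q. (a powi q * b powi p) powi int n = a \<and> (a powi q * b powi p) powi int m = b"
proof -
  obtain p q where pq: "p * int m + q * int n = 1"
    using bezout_int[of "int m" "int n"] assms by auto
  have ab: "a powi int m = b powi int n" using assms by simp
  have "(a powi q * b powi p) powi int n = a powi (q * int n) * (b powi int n) powi p"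
    by (simp only: power_int_mult_distrib power_int_mult[symmetric] mult.commute)
  also have "\<dots> = a powi (q * int n + int m * p)"
    using assms by (simp only: ab[symmetric] power_int_mult[symmetric] power_int_add simp_thms)
  also have "\<dots> = a" using pq by (simp add: algebra_simps)
  finally have 1: "(a powi q * b powi p) powi int n = a" .
  have "(a powi q * b powi p) powi int m = (a powi int m) powi q * b powi (p * int m)"
    by (simp only: power_int_mult_distrib power_int_mult[symmetric] mult.commute)
  also have "\<dots> = b powi (int n * q + p * int m)"
    using assms by (simp only: ab power_int_mult[symmetric] power_int_add simp_thms)
  also have "\<dots> = b" using pq by (simp add: algebra_simps)
  finally show ?thesis using 1 by blast
qed

section \<open>Characters of reducible representations\<close>

definition reducible_character :: "nat \<Rightarrow> nat \<Rightarrow> real \<Rightarrow> gen word set \<Rightarrow> complex" where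
  "reducible_character m n s =
     (\<lambda>g\<in>carrier (torus_group m n).
        of_real (2 * cos (of_int (class_weight m n g) * arccos (s / 2))))"

text \<open>The diagonal representation with angle \<open>arccos (s / 2)\<close> times the weight
  has this character and fixes the line of the first basis vector. Any real angle works, so
  \<open>s\<close> is unrestricted.\<close>

lemma reducible_character_in_Y_red:
  "reducible_character m n s \<in> Y_red (torus_group m n)"
proof -
  let ?G = "torus_group m n"
  define \<rho> where "\<rho> g = torus_diag (cis (of_int (class_weight m n g) * arccos (s / 2)))" for g
  have "\<rho> \<in> hom ?G SU2"
  proof (rule homI)
    fix g h assume "g \<in> carrier ?G" "h \<in> carrier ?G"
    then obtain u v where "g = torus_class m n u" "h = torus_class m n v"
      unfolding carrier_torus_group by blast
    then show "\<rho> (g \<otimes>\<^bsub>?G\<^esub> h) = \<rho> g \<otimes>\<^bsub>SU2\<^esub> \<rho> h"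
      by (simp add: \<rho>_def torus_class_mult SU2_def torus_diag_mult[symmetric] cis_mult
          distrib_right)
  qed (simp add: \<rho>_def torus_diag_SU2)
  moreover have "reducible_rep ?G \<rho>"
    unfolding reducible_rep_def
  proof (intro exI conjI ballI)
    show "axis 1 1 \<noteq> (0::complex^2)" by (simp add: axis_eq_0_iff)
    show "\<rho> g *v axis 1 1
        = cis (of_int (class_weight m n g) * arccos (s / 2)) *s axis 1 1" for g
      by (simp add: \<rho>_def torus_diag_def vec_eq_iff forall_2 matrix_vector_mult_def sum_2 axis_def)
  qed
  moreover have "rep_character ?G \<rho> = reducible_character m n s"
    by (simp add: rep_character_def reducible_character_def \<rho>_def trace_torus_diag)
  ultimately show ?thesis unfolding Y_red_def by (metis (mono_tags, lifting) image_eqI mem_Collect_eq)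
qed

text \<open>The angles \<open>arccos (cos t)\<close> and \<open>t\<close> agree up to sign and
  multiples of \<open>2 * pi\<close>. Integer powers of \<open>cis\<close> remove the second
  ambiguity, evenness of the cosine the first.\<close>

lemma cos_of_int_mult_arccos_cos: "cos (of_int k * arccos (cos t)) = cos (of_int k * t)"
proof -
  let ?a = "arccos (cos t)"
  have c: "cos ?a = cos t" by simp
  have "(sin ?a)\<^sup>2 = (sin t)\<^sup>2" by (simp add: sin_squared_eq)
  then have "sin ?a = sin t \<or> sin ?a = - sin t" by (simp add: power2_eq_iff)
  then have "cis ?a = cis t \<or> cis ?a = cis (- t)"
    using c by (auto simp: complex_eq_iff)
  then have "cis ?a powi k = cis t powi k \<or> cis ?a powi k = cis (- t) powi k" by metis
  then show ?thesis
    by (auto simp: cis_power_int complex_eq_iff)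
qed

lemma Y_red_eq:
  assumes mn: "coprime m n"
  shows "Y_red (torus_group m n) = reducible_character m n ` {-2..2}"
proof (intro equalityI subsetI)
  let ?G = "torus_group m n"
  let ?K = "torus_class m n"
  fix ch assume "ch \<in> Y_red ?G"
  then obtain \<rho> where hom: "\<rho> \<in> hom ?G SU2" and red: "reducible_rep ?G \<rho>"
    and ch: "ch = rep_character ?G \<rho>"
    by (auto simp: Y_red_def)
  obtain v where v: "v \<noteq> 0" and "\<forall>g\<in>carrier ?G. \<exists>c. \<rho> g *v v = c *s v"
    using red unfolding reducible_rep_def by blast
  then have "\<forall>u. \<exists>c. \<rho> (?K u) *v v = c *s v" by (simp add: carrier_torus_group)
  \<comment> \<open>Eigenvalues are indexed by words rather than classes, so that they can be
    computed by induction on letters.\<close>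
  then obtain c where c: "\<And>u. \<rho> (?K u) *v v = c u *s v" by metis
  have SU: "\<rho> (?K u) \<in> carrier SU2" for u
    using hom by (auto simp: hom_def carrier_torus_group)
  then have norm: "cmod (c u) = 1" for u
    using unitary_eigenvalue_norm[OF _ v c] by (auto simp: SU2_def)
  then have nz: "c u \<noteq> 0" for u by (metis norm_zero zero_neq_one)
  \<comment> \<open>Since \<open>v\<close> is nonzero, identities between the matrices pass to their
    eigenvalues.\<close>
  have inj: "a = b" if "a *s v = b *s v" for a b
    using that v by (auto simp: vec_eq_iff)
  have app: "c (u @ w) = c u * c w" for u w
  proof (rule inj)
    have "\<rho> (?K (u @ w)) = \<rho> (?K u) ** \<rho> (?K w)"
      using hom by (auto simp: hom_def carrier_torus_group torus_class_mult[symmetric] SU2_def)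
    then have "\<rho> (?K (u @ w)) *v v = \<rho> (?K u) *v (c w *s v)"
      by (simp add: matrix_vector_mul_assoc[symmetric] c)
    also have "\<dots> = c w *s (\<rho> (?K u) *v v)" by (rule vector_scalar_commute)
    finally show "c (u @ w) *s v = (c u * c w) *s v"
      by (simp add: c mult.commute)
  qed
  have cong: "c u = c w" if "?K u = ?K w" for u w
    using c[of u] c[of w] that by (metis inj)
  have one: "c [] = 1" using app[of "[]" "[]"] nz[of "[]"] by simp
  have rep: "c (replicate k a) = c [a] ^ k" for k a
  proof (induction k)
    case (Suc k) then show ?case using app[of "[a]" "replicate k a"] by simp
  qed (simp add: one)
  have inv: "c [(s, False)] = inverse (c [(s, True)])" for s
  proof -
    have "c [(s, True), (s, False)] = c []"
      using pres_eq.cancel[of _ s True] by (intro cong) (simp add: word_class_eq_iff)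
    then show ?thesis using app[of "[(s, True)]" "[(s, False)]"] nz
      by (simp add: one inverse_unique)
  qed
  let ?a = "c [(X, True)]" and ?b = "c [(Y, True)]"
  have "c (replicate m (X, True)) = c (replicate n (Y, True))"
    by (intro cong) (simp add: word_class_eq_iff pres_eq.relation)
  then have "?a ^ m = ?b ^ n" by (simp add: rep)
  then obtain p q where pq: "(?a powi q * ?b powi p) powi int n = ?a"
    "(?a powi q * ?b powi p) powi int m = ?b"
    using coprime_powers_common_base[OF mn nz nz] by blast
  define t where "t = ?a powi q * ?b powi p"
  have "cmod t = 1" by (simp add: t_def norm_mult norm_power_int norm)
  then obtain \<theta> where \<theta>: "t = cis \<theta>" by (metis cis_Arg_unique complex_norm_eq_1_exp cis_conv_exp)
  have gen: "c [(X, True)] = t powi int n" "c [(Y, True)] = t powi int m"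
    using pq by (simp_all add: t_def)
  have letter: "c [a] = t powi letter_weight m n a" for a
    by (cases a; cases "fst a"; cases "snd a")
      (simp_all add: letter_weight_def inv gen power_int_minus)
  have "c u = t powi weight m n u" for u
  proof (induction u)
    case (Cons a u)
    have "t \<noteq> 0" by (simp add: \<theta>)
    then show ?case using app[of "[a]" u] Cons letter by (simp add: power_int_add)
  qed (simp add: one)
  then have "trace (\<rho> (?K u)) = of_real (2 * cos (of_int (weight m n u) * \<theta>))" for u
    using trace_eigenvalue[OF SU v c] by (simp add: \<theta> cis_power_int)
  \<comment> \<open>The angle \<open>arccos (cos \<theta>)\<close> used by
    \<open>reducible_character\<close> may differ from \<open>\<theta>\<close>;
    \<open>cos_of_int_mult_arccos_cos\<close> shows that the character is the same.\<close>
  then have "ch = reducible_character m n (2 * cos \<theta>)"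
    by (auto simp: ch rep_character_def reducible_character_def carrier_torus_group
        cos_of_int_mult_arccos_cos intro!: restrict_ext)
  moreover have "2 * cos \<theta> \<in> {-2..2}" by simp
  ultimately show "ch \<in> reducible_character m n ` {-2..2}" by blast
qed (use reducible_character_in_Y_red in blast)

section \<open>The homeomorphism with the interval\<close>

theorem proposition4:
  fixes m n :: nat
  assumes "m > 0" and "n > 0" and "coprime m n"
  shows "subtopology (character_variety (torus_group m n)) (Y_red (torus_group m n))
           homeomorphic_space top_of_set {-2..2::real}"
proof -
  let ?G = "torus_group m n"
  let ?P = "product_topology (\<lambda>_. euclidean) (carrier ?G) :: (gen word set \<Rightarrow> complex) topology"
  let ?f = "reducible_character m n"
  obtain u where u: "weight m n u = 1" using exists_weight_one[OF assms(3)] by blast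
  let ?g = "torus_class m n u"
  have g: "?g \<in> carrier ?G" by (simp add: carrier_torus_group)
  have top: "subtopology (character_variety ?G) (Y_red ?G) = subtopology ?P (Y_red ?G)"
    using Y_red_subset[of ?G]
    by (simp add: character_variety_def topspace_character_variety subtopology_subtopology Int_absorb1)
  \<comment> \<open>At weight one the character value is \<open>2 * cos (arccos (s / 2))\<close>, so
    evaluation at \<open>?g\<close> recovers the parameter.\<close>
  have val: "Re (?f s ?g) = s" if "s \<in> {-2..2}" for s
    using that g u by (simp add: reducible_character_def)
  \<comment> \<open>Pointwise convergence reduces continuity to each fixed group element, where
    \<open>arccos\<close> is continuous because \<open>s / 2\<close> stays in
    \<open>[-1,1]\<close>.\<close>
  have "continuous_map (top_of_set {-2..2}) ?P ?f"
    unfolding continuous_map_componentwise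
  proof (intro conjI ballI)
    show "?f ` topspace (top_of_set {-2..2}) \<subseteq> extensional (carrier ?G)"
      by (auto simp: reducible_character_def)
    show "continuous_map (top_of_set {-2..2}) euclidean (\<lambda>s. ?f s h)" if "h \<in> carrier ?G" for h
      using that by (auto simp: reducible_character_def intro!: continuous_intros)
  qed
  then have f: "continuous_map (top_of_set {-2..2}) (subtopology ?P (Y_red ?G)) ?f"
    by (auto simp: continuous_map_in_subtopology reducible_character_in_Y_red)
  have "continuous_map ?P euclidean (\<lambda>ch. ch ?g)"
    using g by (rule continuous_map_product_projection)
  then have "continuous_map ?P euclidean (Re \<circ> (\<lambda>ch. ch ?g))"
    by (rule continuous_map_compose) (auto intro!: continuous_intros)
  \<comment> \<open>The inverse is the real part of a coordinate projection; by
    \<open>Y_red_eq\<close> and \<open>val\<close> its values on \<open>Y_red\<close> lie in the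
    interval.\<close>
  then have h: "continuous_map (subtopology ?P (Y_red ?G)) (top_of_set {-2..2}) (\<lambda>ch. Re (ch ?g))"
    using val by (auto simp: continuous_map_in_subtopology Y_red_eq[OF assms(3)] o_def
        continuous_map_from_subtopology)
  have "homeomorphic_maps (subtopology ?P (Y_red ?G)) (top_of_set {-2..2}) (\<lambda>ch. Re (ch ?g)) ?f"
    unfolding homeomorphic_maps_def
    using f h val by (auto simp: Y_red_eq[OF assms(3)])
  then show ?thesis unfolding top homeomorphic_space_def by blast
qed

end
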